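(* Let $m\ge 1$ be an integer and let $\mathbf{W}\in\mathbb{C}^{m\times m}$ be arbitrary. For each integer $n\ge 1$ let $\mathbb{M}_{n,m}\in\mathbb{C}^{mn\times m(n+1)}$ be the block matrix with $n$ block rows and $n+1$ block columns of $m\times m$ blocks whose $(j,j)$ block is the identity $\mathbf{I}$ and whose $(j,j+1)$ block is $\mathbf{W}$ for $1\le j\le n$, all other blocks being zero. For integers $1\le n_1\le n_2$, $$\sigma_{\min}(\mathbb{M}_{n_2,m})\le\sigma_{\min}(\mathbb{M}_{n_1,m})\quad\text{and}\quad \sigma_{\max}(\mathbb{M}_{n_1,m})\le\sigma_{\max}(\mathbb{M}_{n_2,m}),$$ so that $\kappa(\mathbb{M}_{n_1,m})\le\kappa(\mathbb{M}_{n_2,m})$.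
   Context: The singular values of $\mathbb{M}_{n,m}$ are the square roots of the $mn$ eigenvalues of $\mathbb{M}_{n,m}\mathbb{M}_{n,m}^*$, where $*$ is the Hermitian transpose; $\sigma_{\max}$ and $\sigma_{\min}$ are the largest and smallest of them, and $\kappa(\mathbb{M}_{n,m})=\sigma_{\max}(\mathbb{M}_{n,m})/\sigma_{\min}(\mathbb{M}_{n,m})$ is the condition number. *)

theory Defs
  imports "Jordan_Normal_Form.Spectral_Radius" "Jordan_Normal_Form.Schur_Decomposition"
begin

(* \<open>A * mat_adjoint A\<close> is Hermitian and positive semidefinite, so its eigenvalues are nonnegative
   reals and \<open>sqrt (Re x)\<close> is the genuine square root of an eigenvalue \<open>x\<close>. Singular values
   are collected as a set; multiplicities do not affect the largest and smallest one. *)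
definition singular_values :: "complex mat \<Rightarrow> real set" where
  "singular_values A = (\<lambda>x. sqrt (Re x)) ` spectrum (A * mat_adjoint A)"

(* Meaningful for matrices with at least one row: then the spectrum is finite and nonempty. *)
definition sigma_max :: "complex mat \<Rightarrow> real" where
  "sigma_max A = Max (singular_values A)"

definition sigma_min :: "complex mat \<Rightarrow> real" where
  "sigma_min A = Min (singular_values A)"

definition condition_number :: "complex mat \<Rightarrow> real" where
  "condition_number A = sigma_max A / sigma_min A"

(* With 0-based indices, entry (i, j) lies in block (i div m, j div m), at position
   (i mod m, j mod m) of that block. *)
definition block_bidiag :: "nat \<Rightarrow> nat \<Rightarrow> complex mat \<Rightarrow> complex mat" where
  "block_bidiag n m W = mat (m * n) (m * (n + 1)) (\<lambda>(i, j).
     if j div m = i div m then 1\<^sub>m m $$ (i mod m, j mod m)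
     else if j div m = i div m + 1 then W $$ (i mod m, j mod m)
     else 0)"

end

theory Submission
  imports Defs
begin

text \<open>The entry formula of the block matrix does not depend on the number of block rows, so
  padding a vector \<open>v\<close> with zeros to length \<open>m n\<^sub>2\<close> changes neither \<open>\<parallel>v\<parallel>\<close> nor \<open>\<parallel>M\<^sup>* v\<parallel>\<close>. The
  inequalities follow from the variational characterisation of the extreme eigenvalues of
  \<open>M M\<^sup>*\<close>. Its essential half, that the quadratic form of a Hermitian matrix \<open>A\<close> is bounded by
  its spectral radius, is obtained without a spectral theorem: if the spectral radius is below 1,
  then \<open>\<parallel>A\<^sup>k v\<parallel>\<^sup>2\<close> is a bounded convex sequence in \<open>k\<close>, hence nonincreasing. The condition
  number is monotone because \<open>M\<^sup>*\<close> is injective (its upper block is lower unitriangular), so that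
  the smallest singular value is positive.\<close>

section \<open>Squared Euclidean norm, inner product and adjoint\<close>

definition norm_sq :: "complex vec \<Rightarrow> real" where
  "norm_sq v = (\<Sum>i<dim_vec v. (cmod (v $ i))\<^sup>2)"

lemma norm_sq_nonneg: "norm_sq v \<ge> 0"
  unfolding norm_sq_def by (simp add: sum_nonneg)

lemma norm_sq_pos:
  assumes "v \<in> carrier_vec n" "v \<noteq> 0\<^sub>v n"
  shows "norm_sq v > 0"
proof -
  from assms obtain i where "i < n" "v $ i \<noteq> 0"
    by (metis carrier_vecD eq_vecI index_zero_vec)
  then show ?thesis
    unfolding norm_sq_def using assms by (intro sum_pos2[of _ i]) auto
qed

lemma cscalar_prod_self: "v \<bullet>c v = complex_of_real (norm_sq v)"
  unfolding scalar_prod_def norm_sq_def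
  by (simp add: complex_norm_square lessThan_atLeast0 del: of_real_power)

text \<open>Summing |a - b|^2 >= 0 over the entries. This additive form takes the place of
  Cauchy-Schwarz, both for the convexity of the norm sequence and for bounding a quadratic
  form.\<close>

lemma cscalar_prod_le:
  assumes "x \<in> carrier_vec n" "y \<in> carrier_vec n"
  shows "2 * Re (x \<bullet>c y) \<le> norm_sq x + norm_sq y"
proof -
  have "2 * Re (a * cnj b) \<le> (cmod a)\<^sup>2 + (cmod b)\<^sup>2" for a b
  proof -
    have "0 \<le> (Re a - Re b)\<^sup>2 + (Im a - Im b)\<^sup>2" by simp
    then show ?thesis
      unfolding cmod_power2 by (simp add: power2_eq_square algebra_simps)
  qed
  then have "(\<Sum>i<n. 2 * Re (x $ i * cnj (y $ i))) \<le> (\<Sum>i<n. (cmod (x $ i))\<^sup>2 + (cmod (y $ i))\<^sup>2)"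
    by (rule sum_mono)
  then show ?thesis
    unfolding scalar_prod_def norm_sq_def using assms
    by (simp add: lessThan_atLeast0 sum.distrib sum_distrib_left)
qed

lemma mat_adjoint_dim [simp]:
  "dim_row (mat_adjoint A) = dim_col A" "dim_col (mat_adjoint A) = dim_row A"
  unfolding mat_adjoint_def by auto

lemma mat_adjoint_carrier [simp]:
  "A \<in> carrier_mat n k \<Longrightarrow> mat_adjoint A \<in> carrier_mat k n"
  by auto

lemma index_mat_adjoint [simp]:
  "i < dim_col A \<Longrightarrow> j < dim_row A \<Longrightarrow> mat_adjoint A $$ (i, j) = conjugate (A $$ (j, i))"
  unfolding mat_adjoint_def by (simp add: mat_of_rows_def)

lemma mat_adjoint_mult_self:
  fixes A :: "complex mat"
  shows "mat_adjoint (A * mat_adjoint A) = A * mat_adjoint A"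
  by (rule eq_matI) (auto simp: scalar_prod_def mult.commute)

lemma cscalar_prod_mat_adjoint:
  fixes A :: "complex mat"
  assumes "A \<in> carrier_mat n k" "x \<in> carrier_vec k" "y \<in> carrier_vec n"
  shows "(A *\<^sub>v x) \<bullet>c y = x \<bullet>c (mat_adjoint A *\<^sub>v y)"
proof -
  have "(A *\<^sub>v x) \<bullet>c y = (\<Sum>i<n. \<Sum>j<k. A $$ (i, j) * x $ j * cnj (y $ i))"
    using assms by (auto simp: scalar_prod_def lessThan_atLeast0 sum_distrib_right)
  also have "\<dots> = (\<Sum>j<k. \<Sum>i<n. A $$ (i, j) * x $ j * cnj (y $ i))"
    by (rule sum.swap)
  also have "\<dots> = x \<bullet>c (mat_adjoint A *\<^sub>v y)"
    using assms
    by (auto simp: scalar_prod_def lessThan_atLeast0 sum_distrib_left mult_ac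
        intro!: sum.cong)
  finally show ?thesis .
qed

section \<open>Hermitian matrices of spectral radius below 1 are contractions\<close>

lemma norm_bound_norm_sq_mult:
  assumes A: "A \<in> carrier_mat n n" and v: "v \<in> carrier_vec n" and b: "norm_bound A c"
  shows "norm_sq (A *\<^sub>v v) \<le> real n * (c * (\<Sum>j<n. cmod (v $ j)))\<^sup>2"
proof -
  have "(cmod ((A *\<^sub>v v) $ i))\<^sup>2 \<le> (c * (\<Sum>j<n. cmod (v $ j)))\<^sup>2" if i: "i < n" for i
  proof (rule power_mono)
    have "(A *\<^sub>v v) $ i = (\<Sum>j<n. A $$ (i, j) * v $ j)"
      using A v i by (auto simp: scalar_prod_def lessThan_atLeast0)
    also have "cmod \<dots> \<le> (\<Sum>j<n. c * cmod (v $ j))"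
      using A b i unfolding norm_bound_def
      by (intro sum_norm_le) (auto simp: norm_mult intro!: mult_right_mono)
    finally show "cmod ((A *\<^sub>v v) $ i) \<le> c * (\<Sum>j<n. cmod (v $ j))"
      by (simp add: sum_distrib_left)
  qed simp
  then have "(\<Sum>i<n. (cmod ((A *\<^sub>v v) $ i))\<^sup>2) \<le> (\<Sum>i<n. (c * (\<Sum>j<n. cmod (v $ j)))\<^sup>2)"
    by (intro sum_mono) auto
  then show ?thesis
    unfolding norm_sq_def using A by simp
qed

text \<open>The increments of a convex sequence never decrease, so a positive first increment would
  force at least linear growth and contradict the bound.\<close>

lemma bounded_midconvex_le:
  fixes a :: "nat \<Rightarrow> real"
  assumes conv: "\<And>k. 2 * a (Suc k) \<le> a k + a (Suc (Suc k))" and bound: "\<And>k. a k \<le> C"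
  shows "a 1 \<le> a 0"
proof (rule ccontr)
  assume "\<not> a 1 \<le> a 0"
  then have d: "a 1 - a 0 > 0" by simp
  have step: "a 1 - a 0 \<le> a (Suc k) - a k" for k
  proof (induction k)
    case (Suc k)
    then show ?case using conv[of k] by linarith
  qed simp
  have grow: "real k * (a 1 - a 0) \<le> a k - a 0" for k
  proof (induction k)
    case (Suc k)
    then show ?case using step[of k] by (simp add: algebra_simps)
  qed simp
  obtain k where "C - a 0 < real k * (a 1 - a 0)"
    using reals_Archimedean3[OF d] by blast
  with grow[of k] bound[of k] show False by linarith
qed

lemma hermitian_contraction:
  assumes A: "A \<in> carrier_mat n n" and herm: "mat_adjoint A = A"
    and sr: "spectral_radius A < 1" and v: "v \<in> carrier_vec n"
  shows "norm_sq (A *\<^sub>v v) \<le> norm_sq v"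
proof -
  define u where "u k = (((*\<^sub>v) A) ^^ k) v" for k
  have u: "u k \<in> carrier_vec n" for k
    unfolding u_def by (induction k) (use A v in auto)
  \<comment> \<open>Matrix powers unfold with the extra factor on the right, so the induction has to
    run over all \<open>w\<close> in order to replace \<open>w\<close> by
    \<open>A *\<^sub>v w\<close>.\<close>
  have "(A ^\<^sub>m k) *\<^sub>v w = (((*\<^sub>v) A) ^^ k) w" if "w \<in> carrier_vec n" for k w
    using that
  proof (induction k arbitrary: w)
    case (Suc k)
    have "(A ^\<^sub>m Suc k) *\<^sub>v w = (A ^\<^sub>m k) *\<^sub>v (A *\<^sub>v w)"
      using assoc_mult_mat_vec[of "A ^\<^sub>m k" n n A n w] A Suc.prems by simp
    also have "\<dots> = (((*\<^sub>v) A) ^^ k) (A *\<^sub>v w)"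
      using Suc A by auto
    finally show ?case by (simp add: funpow_swap1)
  qed (use A in auto)
  then have pow: "(A ^\<^sub>m k) *\<^sub>v v = u k" for k
    unfolding u_def using v by blast
  \<comment> \<open>The Jordan normal form supplies one entrywise bound \<open>c\<close> shared by
    all powers of \<open>A\<close>; this makes the sequence of norms bounded.\<close>
  obtain c where c: "\<And>k. norm_bound (A ^\<^sub>m k) c"
    using spectral_radius_jnf_norm_bound_less_1_upper_triangular[OF A sr] by blast
  have "norm_sq (u k) \<le> real n * (c * (\<Sum>j<n. cmod (v $ j)))\<^sup>2" for k
    using norm_bound_norm_sq_mult[OF pow_carrier_mat[OF A] v c] pow by metis
  moreover have "2 * norm_sq (u (Suc k)) \<le> norm_sq (u k) + norm_sq (u (Suc (Suc k)))" for k
  proof -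
    \<comment> \<open>Since \<open>A\<close> is Hermitian, one factor moves across the inner
      product: <A u_k, u_(k+1)> = <u_k, A u_(k+1)>.\<close>
    have "complex_of_real (norm_sq (u (Suc k))) = u k \<bullet>c u (Suc (Suc k))"
      using cscalar_prod_mat_adjoint[OF A u[of k] u[of "Suc k"]]
      unfolding herm cscalar_prod_self[symmetric] by (simp add: u_def)
    then have "norm_sq (u (Suc k)) = Re (u k \<bullet>c u (Suc (Suc k)))"
      by (metis Re_complex_of_real)
    then show ?thesis using cscalar_prod_le[OF u[of k] u[of "Suc (Suc k)"]] by simp
  qed
  ultimately have "norm_sq (u 1) \<le> norm_sq (u 0)"
    by (intro bounded_midconvex_le[of "\<lambda>k. norm_sq (u k)"])
  then show ?thesis by (simp add: u_def)
qed

section \<open>Bounding Hermitian forms by eigenvalues, through scaling and shifting\<close>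

lemma affine_mult_vec:
  fixes A :: "'a :: comm_ring_1 mat"
  assumes A: "A \<in> carrier_mat n n" and v: "v \<in> carrier_vec n"
  shows "(s \<cdot>\<^sub>m A + c \<cdot>\<^sub>m 1\<^sub>m n) *\<^sub>v v = s \<cdot>\<^sub>v (A *\<^sub>v v) + c \<cdot>\<^sub>v v"
proof -
  have "(s \<cdot>\<^sub>m A + c \<cdot>\<^sub>m 1\<^sub>m n) *\<^sub>v v = (s \<cdot>\<^sub>m A) *\<^sub>v v + (c \<cdot>\<^sub>m 1\<^sub>m n) *\<^sub>v v"
    using A v by (intro add_mult_distrib_mat_vec[of _ n n]) auto
  also have "(s \<cdot>\<^sub>m A) *\<^sub>v v = s \<cdot>\<^sub>v (A *\<^sub>v v)"
    using A v by (intro eq_vecI) auto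
  also have "(c \<cdot>\<^sub>m 1\<^sub>m n) *\<^sub>v v = c \<cdot>\<^sub>v v"
    using v by (intro eq_vecI) auto
  finally show ?thesis .
qed

lemma eigenvalue_affine:
  fixes A :: "'a :: field mat"
  assumes A: "A \<in> carrier_mat n n" and s: "s \<noteq> 0"
    and ev: "eigenvalue (s \<cdot>\<^sub>m A + c \<cdot>\<^sub>m 1\<^sub>m n) k"
  shows "eigenvalue A ((k - c) / s)"
proof -
  from ev A obtain v where v: "v \<in> carrier_vec n" "v \<noteq> 0\<^sub>v n"
    and eq: "(s \<cdot>\<^sub>m A + c \<cdot>\<^sub>m 1\<^sub>m n) *\<^sub>v v = k \<cdot>\<^sub>v v"
    unfolding eigenvalue_def eigenvector_def by auto
  have "(s \<cdot>\<^sub>m A + c \<cdot>\<^sub>m 1\<^sub>m n) *\<^sub>v v = s \<cdot>\<^sub>v (A *\<^sub>v v) + c \<cdot>\<^sub>v v"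
    by (rule affine_mult_vec[OF A v(1)])
  with eq have e: "s \<cdot>\<^sub>v (A *\<^sub>v v) + c \<cdot>\<^sub>v v = k \<cdot>\<^sub>v v" by simp
  have "A *\<^sub>v v = ((k - c) / s) \<cdot>\<^sub>v v"
  proof (rule eq_vecI)
    fix i assume "i < dim_vec (((k - c) / s) \<cdot>\<^sub>v v)"
    then have i: "i < n" using v by simp
    have "s * (A *\<^sub>v v) $ i + c * v $ i = k * v $ i"
      using arg_cong[OF e, of "\<lambda>w. w $ i"] A v i by (simp del: index_mult_mat_vec)
    then show "(A *\<^sub>v v) $ i = (((k - c) / s) \<cdot>\<^sub>v v) $ i"
      using s v i by (simp add: field_simps del: index_mult_mat_vec)
  qed (use A v in auto)
  then show ?thesis
    using A v unfolding eigenvalue_def eigenvector_def by auto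
qed

lemma hermitian_eigenvalue_real:
  assumes A: "A \<in> carrier_mat n n" and herm: "mat_adjoint A = A" and ev: "eigenvalue A k"
  shows "Im k = 0"
proof -
  from ev A obtain v where v: "v \<in> carrier_vec n" "v \<noteq> 0\<^sub>v n" and eq: "A *\<^sub>v v = k \<cdot>\<^sub>v v"
    unfolding eigenvalue_def eigenvector_def by auto
  have "k * (v \<bullet>c v) = cnj k * (v \<bullet>c v)"
    using cscalar_prod_mat_adjoint[OF A v(1) v(1)] v
    unfolding herm eq by (simp add: conjugate_smult_vec)
  then have "k = cnj k"
    using norm_sq_pos[OF v] by (simp add: cscalar_prod_self)
  then show ?thesis by (simp add: complex_eq_iff)
qed

lemma cscalar_prod_affine:
  assumes A: "A \<in> carrier_mat n n" and v: "v \<in> carrier_vec n"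
  shows "((s \<cdot>\<^sub>m A + c \<cdot>\<^sub>m 1\<^sub>m n) *\<^sub>v v) \<bullet>c v = s * ((A *\<^sub>v v) \<bullet>c v) + c * (norm_sq v :: real)"
proof -
  have "(s \<cdot>\<^sub>m A + c \<cdot>\<^sub>m 1\<^sub>m n) *\<^sub>v v = s \<cdot>\<^sub>v (A *\<^sub>v v) + c \<cdot>\<^sub>v v"
    by (rule affine_mult_vec[OF A v])
  then show ?thesis
    using A v by (simp add: add_scalar_prod_distrib[of _ n] cscalar_prod_self[symmetric])
qed

lemma mat_adjoint_affine:
  fixes s c :: real
  assumes A: "A \<in> carrier_mat n n" and herm: "mat_adjoint A = A"
  defines "B \<equiv> complex_of_real s \<cdot>\<^sub>m A + complex_of_real c \<cdot>\<^sub>m 1\<^sub>m n"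
  shows "mat_adjoint B = B"
proof (rule eq_matI)
  fix i j assume ij: "i < dim_row B" "j < dim_col B"
  then have "mat_adjoint A $$ (i, j) = conjugate (A $$ (j, i))"
    using A by (intro index_mat_adjoint) (auto simp: B_def)
  then show "mat_adjoint B $$ (i, j) = B $$ (i, j)"
    using A ij unfolding herm by (auto simp: B_def)
qed (use A in \<open>auto simp: B_def\<close>)

text \<open>Scaling by 1/t gives a contraction B, and then 2 Re <Bv, v> <= |Bv|^2 + |v|^2 <= 2
  |v|^2. The strict bound on the moduli puts the spectral radius of B strictly below 1, and the
  existence of an eigenvalue makes \<open>t\<close> positive.\<close>

lemma hermitian_form_le_spectral_bound:
  assumes A: "A \<in> carrier_mat n n" and herm: "mat_adjoint A = A"
    and ev: "\<And>k. eigenvalue A k \<Longrightarrow> cmod k < t" and v: "v \<in> carrier_vec n" and n: "n > 0"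
  shows "Re ((A *\<^sub>v v) \<bullet>c v) \<le> t * norm_sq v"
proof -
  from spectrum_non_empty[OF A n] obtain k where "eigenvalue A k"
    unfolding spectrum_def by auto
  with ev have t: "t > 0" by (meson norm_ge_zero order_le_less_trans)
  \<comment> \<open>The zero shift only brings \<open>B\<close> into the shape covered by the lemmas
    on affine combinations.\<close>
  define B where "B = complex_of_real (1 / t) \<cdot>\<^sub>m A + 0 \<cdot>\<^sub>m 1\<^sub>m n"
  have B: "B \<in> carrier_mat n n" unfolding B_def using A by auto
  have hB: "mat_adjoint B = B"
    using mat_adjoint_affine[OF A herm, of "1 / t" 0] unfolding B_def by simp
  have "cmod k < 1" if "eigenvalue B k" for k
  proof -
    have "eigenvalue A (k * of_real t)"
      using eigenvalue_affine[OF A _ that[unfolded B_def]] t by simp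
    from ev[OF this] t show ?thesis by (simp add: norm_mult)
  qed
  moreover have "spectral_radius B \<in> norm ` spectrum B"
    using spectral_radius_mem_max(1)[OF B n] .
  ultimately have "spectral_radius B < 1"
    unfolding spectrum_def by auto
  from hermitian_contraction[OF B hB this v]
  have "norm_sq (B *\<^sub>v v) \<le> norm_sq v" .
  with cscalar_prod_le[of "B *\<^sub>v v" n v] B v
  have "Re ((B *\<^sub>v v) \<bullet>c v) \<le> norm_sq v" by auto
  then have "Re ((A *\<^sub>v v) \<bullet>c v) / t \<le> norm_sq v"
    unfolding B_def cscalar_prod_affine[OF A v] by simp
  then show ?thesis using t by (simp add: field_simps)
qed

text \<open>Shifting \<open>A\<close> by a multiple of the identity makes all eigenvalues nonnegative, so that the
  bound on their moduli becomes a bound on the eigenvalues themselves.\<close>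

lemma hermitian_form_le:
  assumes A: "A \<in> carrier_mat n n" and herm: "mat_adjoint A = A" and n: "n > 0"
    and s: "s \<noteq> 0" and ev: "\<And>k. eigenvalue A k \<Longrightarrow> s * Re k \<le> b" and v: "v \<in> carrier_vec n"
  shows "s * Re ((A *\<^sub>v v) \<bullet>c v) \<le> b * norm_sq v"
proof (rule field_le_epsilon)
  fix e :: real assume e: "e > 0"
  have fin: "finite (spectrum A)" using card_finite_spectrum[OF A] by simp
  \<comment> \<open>A shift that dominates every |s Re k|, so that all shifted eigenvalues are
    nonnegative.\<close>
  define c where "c = (\<Sum>k\<in>spectrum A. \<bar>s * Re k\<bar>)"
  have c: "0 \<le> s * Re k + c" if "eigenvalue A k" for k
  proof -
    have "\<bar>s * Re k\<bar> \<le> c"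
      unfolding c_def using that fin by (intro member_le_sum) (auto simp: spectrum_def)
    then show ?thesis by linarith
  qed
  \<comment> \<open>The slack \<open>d\<close> yields the strict bound on the moduli and costs at
    most \<open>e\<close> in the form; the added 1 keeps the denominator positive when
    \<open>v\<close> is zero.\<close>
  define d where "d = e / (norm_sq v + 1)"
  have d: "d > 0" "d * norm_sq v \<le> e"
    using e norm_sq_nonneg[of v] by (auto simp: d_def field_simps)
  let ?B = "complex_of_real s \<cdot>\<^sub>m A + complex_of_real c \<cdot>\<^sub>m 1\<^sub>m n"
  have B: "?B \<in> carrier_mat n n" using A by auto
  have "cmod k < b + c + d" if ev': "eigenvalue ?B k" for k
  proof -
    obtain l where l: "eigenvalue A l" and k: "k = of_real s * l + of_real c"
    proof (rule that)
      show "eigenvalue A ((k - of_real c) / of_real s)"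
        using eigenvalue_affine[OF A _ ev'] s by simp
      show "k = of_real s * ((k - of_real c) / of_real s) + of_real c"
        using s by simp
    qed
    \<comment> \<open>The modulus is now |s Re l + c|, and the choice of \<open>c\<close> lets the
      absolute value be dropped.\<close>
    have "Im k = 0"
      using hermitian_eigenvalue_real[OF B mat_adjoint_affine[OF A herm] ev'] .
    then have "cmod k = \<bar>Re k\<bar>" by (simp add: cmod_eq_Re)
    also have "Re k = s * Re l + c" unfolding k by simp
    finally show ?thesis using c[OF l] ev[OF l] d by linarith
  qed
  from hermitian_form_le_spectral_bound[OF B mat_adjoint_affine[OF A herm] this v n]
  have "Re ((?B *\<^sub>v v) \<bullet>c v) \<le> (b + c + d) * norm_sq v" .
  then show "s * Re ((A *\<^sub>v v) \<bullet>c v) \<le> b * norm_sq v + e"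
    unfolding cscalar_prod_affine[OF A v] using d by (simp add: algebra_simps)
qed

section \<open>Extreme singular values as extrema of |M* v|^2 / |v|^2\<close>

lemma norm_sq_adjoint_mult:
  assumes M: "M \<in> carrier_mat n k" and v: "v \<in> carrier_vec n"
  shows "((M * mat_adjoint M) *\<^sub>v v) \<bullet>c v = norm_sq (mat_adjoint M *\<^sub>v v)"
proof -
  have w: "mat_adjoint M *\<^sub>v v \<in> carrier_vec k"
    using mult_mat_vec_carrier[OF mat_adjoint_carrier[OF M] v] .
  have "(M * mat_adjoint M) *\<^sub>v v = M *\<^sub>v (mat_adjoint M *\<^sub>v v)"
    using M v by (intro assoc_mult_mat_vec) auto
  then show ?thesis
    using cscalar_prod_mat_adjoint[OF M w v] by (simp only: cscalar_prod_self)
qed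

lemma finite_singular_values:
  assumes "M \<in> carrier_mat n k"
  shows "finite (singular_values M)"
  using card_finite_spectrum[of "M * mat_adjoint M" n] assms
  unfolding singular_values_def by auto

lemma singular_values_nonempty:
  assumes "M \<in> carrier_mat n k" "n > 0"
  shows "singular_values M \<noteq> {}"
  using spectrum_non_empty[of "M * mat_adjoint M" n] assms
  unfolding singular_values_def by auto

text \<open>Pairing the eigenvector equation with \<open>v\<close> shows Re l |v|^2 = |M* v|^2.
  Hence Re l is nonnegative, and squaring its \<open>sqrt\<close> really gives it back.\<close>

lemma singular_value_attained:
  assumes M: "M \<in> carrier_mat n k" and s: "s \<in> singular_values M"
  shows "s \<ge> 0 \<and> (\<exists>v \<in> carrier_vec n. v \<noteq> 0\<^sub>v n \<and> norm_sq (mat_adjoint M *\<^sub>v v) = s\<^sup>2 * norm_sq v)"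
proof -
  from s M obtain l v where s: "s = sqrt (Re l)" and v: "v \<in> carrier_vec n" "v \<noteq> 0\<^sub>v n"
    and eq: "(M * mat_adjoint M) *\<^sub>v v = l \<cdot>\<^sub>v v"
    unfolding singular_values_def spectrum_def eigenvalue_def eigenvector_def by auto
  have "complex_of_real (norm_sq (mat_adjoint M *\<^sub>v v)) = l * of_real (norm_sq v)"
    using norm_sq_adjoint_mult[OF M v(1)] v unfolding eq by (simp add: cscalar_prod_self)
  from arg_cong[OF this, of Re]
  have N: "norm_sq (mat_adjoint M *\<^sub>v v) = Re l * norm_sq v" by simp
  then have "Re l \<ge> 0"
    using norm_sq_pos[OF v] norm_sq_nonneg by (metis zero_le_mult_iff not_le)
  then show ?thesis using s v N by auto
qed

lemma sigma_max_bound: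
  assumes M: "M \<in> carrier_mat n k" and n: "n > 0" and v: "v \<in> carrier_vec n"
  shows "norm_sq (mat_adjoint M *\<^sub>v v) \<le> (sigma_max M)\<^sup>2 * norm_sq v"
proof -
  have "1 * Re l \<le> (sigma_max M)\<^sup>2" if "eigenvalue (M * mat_adjoint M) l" for l
  proof -
    have mem: "sqrt (Re l) \<in> singular_values M"
      using that unfolding singular_values_def spectrum_def by auto
    then have "sqrt (Re l) \<le> sigma_max M"
      unfolding sigma_max_def using finite_singular_values[OF M] by simp
    then show ?thesis
      using singular_value_attained[OF M mem] by (simp add: sqrt_le_D)
  qed
  from hermitian_form_le[OF mult_carrier_mat[OF M mat_adjoint_carrier[OF M]]
      mat_adjoint_mult_self n _ this v]
  show ?thesis unfolding norm_sq_adjoint_mult[OF M v] by simp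
qed

lemma sigma_min_bound:
  assumes M: "M \<in> carrier_mat n k" and n: "n > 0" and v: "v \<in> carrier_vec n"
  shows "(sigma_min M)\<^sup>2 * norm_sq v \<le> norm_sq (mat_adjoint M *\<^sub>v v)"
proof -
  have "sigma_min M \<in> singular_values M"
    unfolding sigma_min_def
    using finite_singular_values[OF M] singular_values_nonempty[OF M n] by simp
  then have nonneg: "sigma_min M \<ge> 0" using singular_value_attained[OF M] by blast
  \<comment> \<open>The upper bound on forms is applied with s = -1, which turns it into a lower
    bound.\<close>
  have "-1 * Re l \<le> - (sigma_min M)\<^sup>2" if "eigenvalue (M * mat_adjoint M) l" for l
  proof -
    have mem: "sqrt (Re l) \<in> singular_values M"
      using that unfolding singular_values_def spectrum_def by auto
    then have le: "sigma_min M \<le> sqrt (Re l)"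
      unfolding sigma_min_def using finite_singular_values[OF M] by simp
    have "Re l \<ge> 0" using singular_value_attained[OF M mem] by simp
    with power_mono[OF le nonneg, of 2] show ?thesis by simp
  qed
  from hermitian_form_le[OF mult_carrier_mat[OF M mat_adjoint_carrier[OF M]]
      mat_adjoint_mult_self n _ this v]
  show ?thesis unfolding norm_sq_adjoint_mult[OF M v] by simp
qed

lemma singular_values_mem:
  assumes "M \<in> carrier_mat n k" "n > 0"
  shows "sigma_max M \<in> singular_values M" "sigma_min M \<in> singular_values M"
  unfolding sigma_max_def sigma_min_def
  using finite_singular_values[OF assms(1)] singular_values_nonempty[OF assms] by simp_all

text \<open>A vector attaining the extreme value for \<open>M\<close> is carried by \<open>p\<close>
  to a test vector for \<open>M'\<close> with the same quotient, which the extreme values of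
  \<open>M'\<close> must enclose.\<close>

lemma sigma_mono_embedding:
  assumes M: "M \<in> carrier_mat n k" "n > 0" and M': "M' \<in> carrier_mat n' k'" "n' > 0"
    and emb: "\<And>v. v \<in> carrier_vec n \<Longrightarrow> p v \<in> carrier_vec n' \<and> norm_sq (p v) = norm_sq v
      \<and> norm_sq (mat_adjoint M' *\<^sub>v p v) = norm_sq (mat_adjoint M *\<^sub>v v)"
  shows "sigma_min M' \<le> sigma_min M" "sigma_max M \<le> sigma_max M'"
proof -
  note mem = singular_values_mem[OF M]
  have nonneg: "sigma_min M \<ge> 0" "sigma_max M' \<ge> 0"
    using singular_value_attained[OF M(1) mem(2)]
      singular_value_attained[OF M'(1) singular_values_mem(1)[OF M']] by auto
  obtain v where v: "v \<in> carrier_vec n" "v \<noteq> 0\<^sub>v n"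
    "norm_sq (mat_adjoint M *\<^sub>v v) = (sigma_min M)\<^sup>2 * norm_sq v"
    using singular_value_attained[OF M(1) mem(2)] by blast
  have "(sigma_min M')\<^sup>2 * norm_sq v \<le> (sigma_min M)\<^sup>2 * norm_sq v"
    using sigma_min_bound[OF M', of "p v"] emb[OF v(1)] v(3) by simp
  then show "sigma_min M' \<le> sigma_min M"
    using mult_right_le_imp_le[OF _ norm_sq_pos[OF v(1,2)]] power2_le_imp_le nonneg by blast
  obtain v where v: "v \<in> carrier_vec n" "v \<noteq> 0\<^sub>v n"
    "norm_sq (mat_adjoint M *\<^sub>v v) = (sigma_max M)\<^sup>2 * norm_sq v"
    using singular_value_attained[OF M(1) mem(1)] by blast
  have "(sigma_max M)\<^sup>2 * norm_sq v \<le> (sigma_max M')\<^sup>2 * norm_sq v"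
    using sigma_max_bound[OF M', of "p v"] emb[OF v(1)] v(3) by simp
  then show "sigma_max M \<le> sigma_max M'"
    using mult_right_le_imp_le[OF _ norm_sq_pos[OF v(1,2)]] power2_le_imp_le nonneg by blast
qed

lemma sigma_min_pos:
  assumes M: "M \<in> carrier_mat n k" "n > 0"
    and inj: "\<And>v. v \<in> carrier_vec n \<Longrightarrow> mat_adjoint M *\<^sub>v v = 0\<^sub>v k \<Longrightarrow> v = 0\<^sub>v n"
  shows "sigma_min M > 0"
proof -
  from singular_value_attained[OF M(1) singular_values_mem(2)[OF M]] obtain v where
    nonneg: "sigma_min M \<ge> 0" and v: "v \<in> carrier_vec n" "v \<noteq> 0\<^sub>v n"
    and eq: "norm_sq (mat_adjoint M *\<^sub>v v) = (sigma_min M)\<^sup>2 * norm_sq v" by blast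
  have "norm_sq (mat_adjoint M *\<^sub>v v) > 0"
    using norm_sq_pos[OF mult_mat_vec_carrier[OF mat_adjoint_carrier[OF M(1)] v(1)]] inj v by blast
  with eq nonneg show ?thesis by (cases "sigma_min M = 0") auto
qed

section \<open>Structure of the block bidiagonal matrix\<close>

lemma block_bidiag_carrier [simp]: "block_bidiag n m W \<in> carrier_mat (m * n) (m * (n + 1))"
  unfolding block_bidiag_def by simp

text \<open>Free of the number of block rows and defined for all indices, so one function describes
  both matrices and can be evaluated beyond the columns of the smaller one.\<close>

definition block_bidiag_entry :: "nat \<Rightarrow> complex mat \<Rightarrow> nat \<Rightarrow> nat \<Rightarrow> complex" where
  "block_bidiag_entry m W i j =
     (if j div m = i div m then 1\<^sub>m m $$ (i mod m, j mod m)
      else if j div m = i div m + 1 then W $$ (i mod m, j mod m)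
      else 0)"

lemma index_block_bidiag_adjoint_mult:
  assumes "v \<in> carrier_vec (m * n)" "j < m * (n + 1)"
  shows "(mat_adjoint (block_bidiag n m W) *\<^sub>v v) $ j
    = (\<Sum>i<m * n. cnj (block_bidiag_entry m W i j) * v $ i)"
  using assms
  by (auto simp: scalar_prod_def lessThan_atLeast0 block_bidiag_def block_bidiag_entry_def
      intro!: sum.cong)

lemma block_bidiag_entry_diag: "m > 0 \<Longrightarrow> block_bidiag_entry m W j j = 1"
  unfolding block_bidiag_entry_def by simp

text \<open>Left of the diagonal the column block cannot exceed the row block, which excludes
  \<open>W\<close>; inside one block the residues differ, so the identity contributes 0.\<close>

lemma block_bidiag_entry_lower:
  assumes m: "m > 0" and ij: "j < i"
  shows "block_bidiag_entry m W i j = 0"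
proof -
  have "j div m \<le> i div m" using ij by (simp add: div_le_mono)
  moreover have "i mod m \<noteq> j mod m" if "j div m = i div m"
    using that ij by (metis div_mult_mod_eq less_irrefl)
  ultimately show ?thesis
    using m unfolding block_bidiag_entry_def by auto
qed

text \<open>The last nonzero block of row \<open>i\<close> is number i div m + 1 <= n, whereas such
  a column lies in block n + 1 or later.\<close>

lemma block_bidiag_entry_right:
  assumes m: "m > 0" and i: "i < m * n" and j: "m * (n + 1) \<le> j"
  shows "block_bidiag_entry m W i j = 0"
proof -
  have "i div m < n" using i m by (simp add: less_mult_imp_div_less mult.commute)
  moreover have "n + 1 \<le> j div m" using j m
    by (metis div_le_mono nonzero_mult_div_cancel_left less_not_refl2)
  ultimately show ?thesis unfolding block_bidiag_entry_def by auto
qed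

text \<open>Forward substitution in the first m n equations: coordinate \<open>j\<close> of M* v
  involves only v_i with i <= j, and v_j has coefficient 1.\<close>

lemma block_bidiag_adjoint_inj:
  assumes m: "m > 0" and v: "v \<in> carrier_vec (m * n)"
    and eq: "mat_adjoint (block_bidiag n m W) *\<^sub>v v = 0\<^sub>v (m * (n + 1))"
  shows "v = 0\<^sub>v (m * n)"
proof -
  have "v $ j = 0" if "j < m * n" for j
    using that
  proof (induction j rule: less_induct)
    case (less j)
    have "0 = (mat_adjoint (block_bidiag n m W) *\<^sub>v v) $ j"
      using less.prems unfolding eq by simp
    also have "\<dots> = (\<Sum>i<m * n. cnj (block_bidiag_entry m W i j) * v $ i)"
      using less.prems by (intro index_block_bidiag_adjoint_mult[OF v]) simp
    also have "\<dots> = (\<Sum>i<m * n. if i = j then v $ j else 0)"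
    proof (rule sum.cong)
      fix i assume "i \<in> {..<m * n}"
      then show "cnj (block_bidiag_entry m W i j) * v $ i = (if i = j then v $ j else 0)"
        using less.IH block_bidiag_entry_lower[OF m, of j i W] block_bidiag_entry_diag[OF m]
        by (cases i j rule: linorder_cases) auto
    qed simp
    also have "\<dots> = v $ j" using less.prems by simp
    finally show ?case by simp
  qed
  then show ?thesis using v by auto
qed

lemma sum_lessThan_zero_extend:
  fixes f :: "nat \<Rightarrow> 'a :: comm_monoid_add"
  assumes "a \<le> b" "\<And>i. a \<le> i \<Longrightarrow> i < b \<Longrightarrow> f i = 0"
  shows "sum f {..<b} = sum f {..<a}"
  using assms by (intro sum.mono_neutral_right) auto

text \<open>The padded rows contribute nothing to the larger product, and the remaining rows vanish
  in the new columns; so it is the smaller product followed by zeros.\<close>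

lemma block_bidiag_zero_pad:
  assumes m: "m > 0" and n: "n1 \<le> n2" and v: "v \<in> carrier_vec (m * n1)"
  defines "w \<equiv> vec (m * n2) (\<lambda>i. if i < m * n1 then v $ i else 0)"
  shows "norm_sq w = norm_sq v"
    and "norm_sq (mat_adjoint (block_bidiag n2 m W) *\<^sub>v w)
      = norm_sq (mat_adjoint (block_bidiag n1 m W) *\<^sub>v v)"
proof -
  have w: "w \<in> carrier_vec (m * n2)" unfolding w_def by simp
  have le: "m * n1 \<le> m * n2" "m * (n1 + 1) \<le> m * (n2 + 1)" using n by simp_all
  have w_low: "w $ i = v $ i" if "i < m * n1" for i
    using that less_le_trans[OF that le(1)] unfolding w_def by simp
  have w_high: "w $ i = 0" if "m * n1 \<le> i" "i < m * n2" for i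
    using that unfolding w_def by simp
  have "norm_sq w = (\<Sum>i<m * n2. (cmod (w $ i))\<^sup>2)"
    unfolding norm_sq_def using w by simp
  also have "\<dots> = (\<Sum>i<m * n1. (cmod (w $ i))\<^sup>2)"
    by (intro sum_lessThan_zero_extend le) (simp add: w_high)
  also have "\<dots> = norm_sq v"
    unfolding norm_sq_def using v by (intro sum.cong) (auto simp: w_low)
  finally show "norm_sq w = norm_sq v" .
  let ?g = "\<lambda>j. \<Sum>i<m * n1. cnj (block_bidiag_entry m W i j) * v $ i"
  have pad: "(mat_adjoint (block_bidiag n2 m W) *\<^sub>v w) $ j = ?g j" if "j < m * (n2 + 1)" for j
  proof -
    have "(mat_adjoint (block_bidiag n2 m W) *\<^sub>v w) $ j
      = (\<Sum>i<m * n2. cnj (block_bidiag_entry m W i j) * w $ i)"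
      using index_block_bidiag_adjoint_mult[OF w that] .
    also have "\<dots> = (\<Sum>i<m * n1. cnj (block_bidiag_entry m W i j) * w $ i)"
      by (intro sum_lessThan_zero_extend le) (simp add: w_high)
    also have "\<dots> = ?g j"
      by (intro sum.cong) (auto simp: w_low)
    finally show ?thesis .
  qed
  have dims: "dim_col (block_bidiag n m W) = m * (n + 1)" for n
    unfolding block_bidiag_def by simp
  have "norm_sq (mat_adjoint (block_bidiag n2 m W) *\<^sub>v w)
    = (\<Sum>j<m * (n2 + 1). (cmod (?g j))\<^sup>2)"
    unfolding norm_sq_def dim_mult_mat_vec mat_adjoint_dim dims
    by (rule sum.cong) (use pad in auto)
  also have "\<dots> = (\<Sum>j<m * (n1 + 1). (cmod (?g j))\<^sup>2)"
    by (intro sum_lessThan_zero_extend le) (simp add: block_bidiag_entry_right[OF m])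
  also have "\<dots> = norm_sq (mat_adjoint (block_bidiag n1 m W) *\<^sub>v v)"
    unfolding norm_sq_def dim_mult_mat_vec mat_adjoint_dim dims
    by (rule sum.cong) (simp_all add: index_block_bidiag_adjoint_mult[OF v] del: index_mult_mat_vec)
  finally show "norm_sq (mat_adjoint (block_bidiag n2 m W) *\<^sub>v w)
      = norm_sq (mat_adjoint (block_bidiag n1 m W) *\<^sub>v v)" .
qed

theorem proposition3p28:
  fixes m n1 n2 :: nat and W :: "complex mat"
  assumes "m \<ge> 1" and "W \<in> carrier_mat m m"
    and "1 \<le> n1" and "n1 \<le> n2"
  shows "sigma_min (block_bidiag n2 m W) \<le> sigma_min (block_bidiag n1 m W)
    \<and> sigma_max (block_bidiag n1 m W) \<le> sigma_max (block_bidiag n2 m W)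
    \<and> condition_number (block_bidiag n1 m W) \<le> condition_number (block_bidiag n2 m W)"
proof -
  let ?M1 = "block_bidiag n1 m W" and ?M2 = "block_bidiag n2 m W"
  let ?p = "\<lambda>v. vec (m * n2) (\<lambda>i. if i < m * n1 then v $ i else 0)"
  have m: "m > 0" and pos: "m * n1 > 0" "m * n2 > 0" using assms by auto
  have emb: "?p v \<in> carrier_vec (m * n2) \<and> norm_sq (?p v) = norm_sq v
      \<and> norm_sq (mat_adjoint ?M2 *\<^sub>v ?p v) = norm_sq (mat_adjoint ?M1 *\<^sub>v v)"
    if "v \<in> carrier_vec (m * n1)" for v
    using block_bidiag_zero_pad[OF m assms(4) that] by simp
  note mono = sigma_mono_embedding[OF block_bidiag_carrier pos(1) block_bidiag_carrier pos(2), OF emb]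
  \<comment> \<open>Positivity of the smaller denominator is essential for comparing the quotients,
    since division by zero yields 0 here.\<close>
  have "sigma_min ?M2 > 0"
    by (rule sigma_min_pos[OF block_bidiag_carrier pos(2) block_bidiag_adjoint_inj[OF m]])
  moreover have "sigma_max ?M2 \<ge> 0"
    using singular_value_attained[OF block_bidiag_carrier]
      singular_values_mem(1)[OF block_bidiag_carrier pos(2)] by blast
  ultimately have "condition_number ?M1 \<le> condition_number ?M2"
    unfolding condition_number_def using mono by (intro frac_le) auto
  with mono show ?thesis by blast
qed

end
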